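(* Let $\mathbb X,\mathbb Y,\mathbb V$ be separable metric spaces, let $f:\mathbb X\times\mathbb V\to\mathbb X$ and $g:\mathbb Y\times\mathbb V\to\mathbb Y$ be measurable, and let $(v_n)_{n\in\mathbb Z}$ be an IID sequence of $\mathbb V$-valued random variables. Let $X$ and $Y$ be the stochastic recursive sequences respectively driven by $(f,(v_n)_{n\in\mathbb Z})$ and $(g,(v_n)_{n\in\mathbb Z})$. Suppose that $X$ is $q$-controlled by $Y$ for $b_1,\dots,b_q,y\in\mathbb Y$ and $a_1,\dots,a_q\in\mathbb X$ (where $q\in\mathbb N^*$), and that $$\mathbb P\left[\tau^Y_{b_i}(y)<\infty\right]=1,\qquad i\in\{1,\dots,q\}.$$ Then the perfect sampling algorithm by control (described in the context) terminates almost surely, and its output is sampled from the unique stationary distribution of the Markov chain $X$.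
   Context: Stochastic recursive sequences (SRS). For $k\in\mathbb Z$ and $x\in\mathbb X$, the SRS driven by $(f,(v_n)_{n\in\mathbb Z})$ with value $x$ at time $k$ is the sequence $(X^k_n(x))_{n\ge k}$ defined by $X^k_k(x)=x$ and $X^k_{n+1}(x)=f(X^k_n(x),v_n)$ for $n\ge k$. Similarly $Y^k_k(y)=y$, $Y^k_{n+1}(y)=g(Y^k_n(y),v_n)$. Since $(v_n)$ is IID, these are Markov chains. Hitting times. $\tau^{Y,k}_e(y)=\inf\{n\ge k: Y^k_n(y)=e\}$. Since the input is IID, the law of $\tau^{Y,k}_e(y)-k$ does not depend on $k$; $\tau^Y_e(y)$ denotes a generic random variable with this law. Control. $Y$ $q$-controls $X$ for $b_1,\dots,b_q,y\in\mathbb Y$ and $a_1,\dots,a_q\in\mathbb X$ if for all $i\in\{1,\dots,q\}$, all $k\in\mathbb Z$ and all $n\ge k$, $$\left[Y^k_n(y)=b_i\right]\Longrightarrow\left[\forall x\in\mathbb X,\ X^k_n(x)=a_i\right].$$ The algorithm. For successive starting times $T=-1,-2,-4,-8,\dots$ (that is $T=-2^j$, $j=0,1,2,\dots$), using one and the same realization of the inputs $v_n$, $n<0$ (drawn as needed), run $Y$ from the value $y$ at time $T$, i.e. compute $Y^T_n(y)$ for $n=T,T+1,\dots$, until the first time $i\le 0$ at which $Y^T_i(y)\in\{b_1,\dots,b_q\}$. If there is no such $i\le 0$, pass to the next starting time $2T$. If there is, let $k$ be such that $Y^T_i(y)=b_k$, and output $X^i_0(a_k)$, i.e. set $X=a_k$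 at time $i$ and apply $X\leftarrow f(X,v_n)$ for $n=i,\dots,-1$. The algorithm terminates if some starting time leads to an output. *)

theory Defs
  imports "HOL-Probability.Probability"
begin

definition iid_sequence :: "'w measure \<Rightarrow> (int \<Rightarrow> 'w \<Rightarrow> 'v::metric_space) \<Rightarrow> bool" where
  "iid_sequence M v \<longleftrightarrow>
     prob_space M \<and>
     prob_space.indep_vars M (\<lambda>_. borel) v UNIV \<and>
     (\<forall>m n. distr M borel (v m) = distr M borel (v n))"

(* A stochastic recursive sequence is defined pathwise: vs is one realization of the inputs. *)
primrec srs_steps :: "('s \<times> 'v \<Rightarrow> 's) \<Rightarrow> (int \<Rightarrow> 'v) \<Rightarrow> int \<Rightarrow> 's \<Rightarrow> nat \<Rightarrow> 's" where
  "srs_steps f vs k s 0 = s"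
| "srs_steps f vs k s (Suc m) = f (srs_steps f vs k s m, vs (k + int m))"

(* srs f vs k s n is the value at time n of the sequence having value s at time k.
   It is meant for n \<ge> k only; for n < k the truncation of nat makes it equal to s. *)
definition srs :: "('s \<times> 'v \<Rightarrow> 's) \<Rightarrow> (int \<Rightarrow> 'v) \<Rightarrow> int \<Rightarrow> 's \<Rightarrow> int \<Rightarrow> 's" where
  "srs f vs k s n = srs_steps f vs k s (nat (n - k))"

lemma srs_start: "srs f vs k s k = s"
  by (simp add: srs_def)

lemma srs_step:
  assumes "k \<le> n"
  shows "srs f vs k s (n + 1) = f (srs f vs k s n, vs n)"
proof -
  have "nat (n + 1 - k) = Suc (nat (n - k))" "k + int (nat (n - k)) = n"
    using assms by auto
  then show ?thesis by (simp add: srs_def)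
qed

(* The infimum of the empty set is \<infinity> in ereal. *)
definition hitting_time :: "('s \<times> 'v \<Rightarrow> 's) \<Rightarrow> (int \<Rightarrow> 'v) \<Rightarrow> int \<Rightarrow> 's \<Rightarrow> 's \<Rightarrow> ereal" where
  "hitting_time g vs k s e = (INF n \<in> {n. k \<le> n \<and> srs g vs k s n = e}. ereal (of_int n))"

(* The generic hitting time has the law of the hitting time from k minus k, which for IID
   inputs does not depend on k; k = 0 is the representative used here. *)
definition generic_hitting_time ::
    "('s \<times> 'v \<Rightarrow> 's) \<Rightarrow> (int \<Rightarrow> 'w \<Rightarrow> 'v) \<Rightarrow> 's \<Rightarrow> 's \<Rightarrow> 'w \<Rightarrow> ereal" where
  "generic_hitting_time g v s e \<omega> = hitting_time g (\<lambda>n. v n \<omega>) 0 s e"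

definition q_controls ::
    "'w measure \<Rightarrow> (int \<Rightarrow> 'w \<Rightarrow> 'v) \<Rightarrow> ('y \<times> 'v \<Rightarrow> 'y) \<Rightarrow> ('x \<times> 'v \<Rightarrow> 'x) \<Rightarrow>
     nat \<Rightarrow> (nat \<Rightarrow> 'y) \<Rightarrow> 'y \<Rightarrow> (nat \<Rightarrow> 'x) \<Rightarrow> bool" where
  "q_controls M v g f q b y a \<longleftrightarrow>
     (\<forall>i\<in>{1..q}. \<forall>k n. k \<le> n \<longrightarrow>
        (\<forall>\<omega>\<in>space M. srs g (\<lambda>n. v n \<omega>) k y n = b i \<longrightarrow>
           (\<forall>x. srs f (\<lambda>n. v n \<omega>) k x n = a i)))"

definition start_time :: "nat \<Rightarrow> int" where
  "start_time j = - (2 ^ j)"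

definition control_times ::
    "('y \<times> 'v \<Rightarrow> 'y) \<Rightarrow> (int \<Rightarrow> 'v) \<Rightarrow> nat \<Rightarrow> (nat \<Rightarrow> 'y) \<Rightarrow> 'y \<Rightarrow> int \<Rightarrow> int set" where
  "control_times g vs q b y T = {i. T \<le> i \<and> i \<le> 0 \<and> srs g vs T y i \<in> b ` {1..q}}"

(* None means that no starting time leads to an output. The points b k need not be distinct;
   SOME is an arbitrary choice among the indices k matching the state reached. *)
definition control_sampling ::
    "('x \<times> 'v \<Rightarrow> 'x) \<Rightarrow> ('y \<times> 'v \<Rightarrow> 'y) \<Rightarrow> (int \<Rightarrow> 'v) \<Rightarrow>
     nat \<Rightarrow> (nat \<Rightarrow> 'y) \<Rightarrow> 'y \<Rightarrow> (nat \<Rightarrow> 'x) \<Rightarrow> 'x option" where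
  "control_sampling f g vs q b y a =
     (if \<exists>j. control_times g vs q b y (start_time j) \<noteq> {}
      then
        let T = start_time (LEAST j. control_times g vs q b y (start_time j) \<noteq> {});
            i = Min (control_times g vs q b y T);
            k = (SOME k. k \<in> {1..q} \<and> srs g vs T y i = b k)
        in Some (srs f vs i (a k) 0)
      else None)"

(* For IID inputs the transition kernel does not depend on the time of the input; time 0 is used. *)
definition srs_kernel ::
    "'w measure \<Rightarrow> (int \<Rightarrow> 'w \<Rightarrow> 'v) \<Rightarrow> ('x::metric_space \<times> 'v \<Rightarrow> 'x) \<Rightarrow> 'x \<Rightarrow> 'x measure" where
  "srs_kernel M v f x = distr M borel (\<lambda>\<omega>. f (x, v 0 \<omega>))"

definition stationary_distribution ::
    "('x::metric_space \<Rightarrow> 'x measure) \<Rightarrow> 'x measure \<Rightarrow> bool" where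
  "stationary_distribution K \<pi> \<longleftrightarrow>
     prob_space \<pi> \<and> sets \<pi> = sets borel \<and>
     (\<forall>A\<in>sets borel. emeasure \<pi> A = (\<integral>\<^sup>+x. emeasure (K x) A \<partial>\<pi>))"

end

theory Submission
  imports Defs
begin

text \<open>
  The argument is coupling from the past. If \<open>Y\<close>, started from \<open>y\<close> at time \<open>T\<close>, visits some
  \<open>b i\<close> at a time \<open>n \<le> 0\<close>, then control forces every path of \<open>X\<close> started at time \<open>T\<close> through
  the point \<open>a i\<close> at time \<open>n\<close>. All these paths therefore share one value at time 0, and that value
  is what the algorithm outputs (\<open>coalescence\<close>). A path started before \<open>T\<close> is at time \<open>T\<close> just
  another starting point, so it ends in the same value (\<open>control_sampling_eq\<close>): the output \<open>Z\<close> is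
  almost surely the eventual value at time 0 of the paths \<open>X\<^sup>-\<^sup>n(x)\<close>, whatever \<open>x\<close> is.

  For inputs that are independent and identically distributed, the value after \<open>n\<close> steps from \<open>x\<close> has
  a law given by \<open>n\<close> applications of the transition kernel, hence independent of the starting time
  (\<open>srs_law_Suc\<close>, \<open>srs_law_shift\<close>). So the \<open>n\<close>-step law from \<open>x\<close> is the law of the value at time 0
  of the path started at \<open>-n\<close>, and these values are eventually equal to \<open>Z\<close>. Dominated convergence
  shows that the \<open>n\<close>-step laws converge to the law of \<open>Z\<close>, tested against every bounded measurable
  function and not only the continuous ones. This gives stationarity by letting \<open>n\<close> tend to infinity
  in \<open>law (n + 1) = law n \<bind> kernel\<close>, and uniqueness by averaging the convergence over the starting
  point \<open>x\<close> with respect to a stationary distribution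
  (\<open>stationary_distribution_coupling_limit\<close>, \<open>stationary_distribution_unique\<close>).

  The algorithm terminates because the probability that \<open>Y\<close> visits \<open>b 1\<close> between \<open>-2\<^sup>j\<close> and 0 is the
  probability that it does so between 0 and \<open>2\<^sup>j\<close>, which tends to 1
  (\<open>AE_hits_from_the_past\<close>).
\<close>

section \<open>Paths of a stochastic recursive sequence\<close>

lemma srs_flow:
  assumes "k \<le> m" and "m \<le> n"
  shows "srs f vs k s n = srs f vs m (srs f vs k s m) n"
proof -
  have add: "srs_steps f vs k s (i + j) = srs_steps f vs (k + int i) (srs_steps f vs k s i) j" for i j
    by (induction j) (simp_all add: add.assoc)
  have "nat (n - k) = nat (m - k) + nat (n - m)"
    using assms by simp
  then show ?thesis
    using add[of "nat (m - k)" "nat (n - m)"] assms by (simp add: srs_def)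
qed

text \<open>
  Only the inputs actually read have to be measurable. This lets the path be a function on the product
  space of a block of inputs, which is how independence from the later inputs is used below.
\<close>

lemma measurable_srs_steps:
  assumes f: "f \<in> borel \<Otimes>\<^sub>M borel \<rightarrow>\<^sub>M borel"
    and w: "\<And>i. k \<le> i \<Longrightarrow> i < k + int n \<Longrightarrow> (\<lambda>\<omega>. w \<omega> i) \<in> N \<rightarrow>\<^sub>M borel"
  shows "(\<lambda>\<omega>. srs_steps f (w \<omega>) k s n) \<in> N \<rightarrow>\<^sub>M borel"
  using w
proof (induction n)
  case (Suc n)
  have "(\<lambda>\<omega>. (srs_steps f (w \<omega>) k s n, w \<omega> (k + int n))) \<in> N \<rightarrow>\<^sub>M borel \<Otimes>\<^sub>M borel"
    using Suc by (intro measurable_Pair) auto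
  then show ?case
    using measurable_compose[OF _ f] by simp
qed simp

text \<open>
  Making \<open>e\<close> absorbing turns the event of hitting \<open>e\<close> within \<open>n\<close> steps, which concerns a whole path,
  into an event about the state after \<open>n\<close> steps. The time invariance of one-dimensional laws
  then applies to hitting times as well.
\<close>

definition stopped :: "('s \<times> 'v \<Rightarrow> 's) \<Rightarrow> 's \<Rightarrow> 's \<times> 'v \<Rightarrow> 's" where
  "stopped g e p = (if fst p = e then e else g p)"

lemma srs_steps_stopped:
  "srs_steps (stopped g e) vs k s n =
     (if \<exists>m\<le>n. srs_steps g vs k s m = e then e else srs_steps g vs k s n)"
proof (induction n)
  case (Suc n)
  then show ?case
    by (auto simp: stopped_def le_Suc_eq)
qed auto

lemma measurable_stopped:
  fixes g :: "'s::metric_space \<times> 'v::metric_space \<Rightarrow> 's"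
  assumes "g \<in> borel \<Otimes>\<^sub>M borel \<rightarrow>\<^sub>M borel"
  shows "stopped g e \<in> borel \<Otimes>\<^sub>M borel \<rightarrow>\<^sub>M borel"
proof -
  have "Measurable.pred (borel \<Otimes>\<^sub>M borel) (\<lambda>p :: 's \<times> 'v. fst p \<in> {e})"
    by measurable
  then have "(\<lambda>p. if fst p \<in> {e} then e else g p) \<in> borel \<Otimes>\<^sub>M borel \<rightarrow>\<^sub>M borel"
    using assms by (intro measurable_If) (auto simp: pred_def)
  then show ?thesis
    by (simp add: stopped_def[abs_def])
qed

lemma hitting_time_finite_iff:
  "hitting_time g vs 0 s e < \<infinity> \<longleftrightarrow> (\<exists>n. srs_steps (stopped g e) vs 0 s n = e)"
proof -
  have "hitting_time g vs 0 s e < \<infinity> \<longleftrightarrow> (\<exists>n\<ge>0. srs g vs 0 s n = e)"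
    unfolding hitting_time_def INF_less_iff by auto
  also have "\<dots> \<longleftrightarrow> (\<exists>m. srs_steps g vs 0 s m = e)"
  proof
    assume "\<exists>m. srs_steps g vs 0 s m = e"
    then obtain m where "srs g vs 0 s (int m) = e"
      by (auto simp: srs_def)
    then show "\<exists>n\<ge>0. srs g vs 0 s n = e"
      by (intro exI[of _ "int m"]) simp
  qed (auto simp: srs_def)
  also have "\<dots> \<longleftrightarrow> (\<exists>n. srs_steps (stopped g e) vs 0 s n = e)"
    by (auto simp: srs_steps_stopped)
  finally show ?thesis .
qed

section \<open>What the algorithm outputs\<close>

text \<open>
  At time \<open>i\<close> the path from \<open>x\<close> has been driven to \<open>a k\<close>, and from then on it is the path that the
  algorithm computes.
\<close>

lemma coalescence:
  assumes control: "\<And>i k n x. i \<in> {1..q} \<Longrightarrow> k \<le> n \<Longrightarrow> srs g vs k y n = b i \<Longrightarrow> srs f vs k x n = a i"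
    and "k \<in> {1..q}" and "T \<le> i" and "i \<le> 0" and "srs g vs T y i = b k"
  shows "srs f vs T x 0 = srs f vs i (a k) 0"
  using srs_flow[of T i 0 f vs x] control[of k T i x] assms(2-) by simp

text \<open>
  Starting even earlier than the algorithm does not change the value at time 0: the state reached at the
  algorithm's own starting time is one more initial point, and coalescence holds for all of them. The
  arbitrary choice of an index among those with the same \<open>b k\<close> is harmless for the same reason.
\<close>

lemma control_sampling_eq:
  fixes g :: "'y \<times> 'v \<Rightarrow> 'y" and f :: "'x \<times> 'v \<Rightarrow> 'x"
  assumes control: "\<And>i k n x. i \<in> {1..q} \<Longrightarrow> k \<le> n \<Longrightarrow> srs g vs k y n = b i \<Longrightarrow> srs f vs k x n = a i"
    and halt: "\<exists>j. control_times g vs q b y (start_time j) \<noteq> {}"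
    and "T \<le> start_time (LEAST j. control_times g vs q b y (start_time j) \<noteq> {})"
  shows "control_sampling f g vs q b y a = Some (srs f vs T x 0)"
proof -
  define S where "S = start_time (LEAST j. control_times g vs q b y (start_time j) \<noteq> {})"
  define i where "i = Min (control_times g vs q b y S)"
  define k where "k = (SOME k. k \<in> {1..q} \<and> srs g vs S y i = b k)"
  have "control_times g vs q b y S \<noteq> {}"
    unfolding S_def using halt by (rule LeastI_ex)
  moreover have "finite (control_times g vs q b y S)"
    by (rule finite_subset[of _ "{S..0}"]) (auto simp: control_times_def)
  ultimately have "i \<in> control_times g vs q b y S"
    unfolding i_def by (rule Min_in[rotated])
  then have i: "S \<le> i" "i \<le> 0" and "\<exists>k. k \<in> {1..q} \<and> srs g vs S y i = b k"
    by (auto simp: control_times_def)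
  from this(3) have k: "k \<in> {1..q} \<and> srs g vs S y i = b k"
    unfolding k_def by (rule someI_ex)
  have "srs f vs T x 0 = srs f vs S (srs f vs T x S) 0"
    using assms(3) i by (intro srs_flow) (auto simp: S_def)
  also have "\<dots> = srs f vs i (a k) 0"
    by (rule coalescence[where g = g and b = b and y = y, OF control]) (use k i in auto)
  finally show ?thesis
    using halt by (simp add: control_sampling_def Let_def S_def i_def k_def)
qed

section \<open>Laws along the sequence\<close>

locale iid_inputs = prob_space M for M :: "'w measure" +
  fixes v :: "int \<Rightarrow> 'w \<Rightarrow> 'v::metric_space"
  assumes indep: "indep_vars (\<lambda>_. borel) v UNIV"
    and ident: "distr M borel (v m) = distr M borel (v n)"
begin

lemma measurable_input [measurable]: "v n \<in> M \<rightarrow>\<^sub>M borel"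
  using indep by (auto simp: indep_vars_def2)

definition srs_law :: "('s::metric_space \<times> 'v \<Rightarrow> 's) \<Rightarrow> int \<Rightarrow> nat \<Rightarrow> 's \<Rightarrow> 's measure" where
  "srs_law f k n s = distr M borel (\<lambda>\<omega>. srs_steps f (\<lambda>i. v i \<omega>) k s n)"

context
  fixes f :: "'s::metric_space \<times> 'v \<Rightarrow> 's"
  assumes f [measurable]: "f \<in> borel \<Otimes>\<^sub>M borel \<rightarrow>\<^sub>M borel"
begin

lemma measurable_path [measurable]: "(\<lambda>\<omega>. srs_steps f (\<lambda>i. v i \<omega>) k s n) \<in> M \<rightarrow>\<^sub>M borel"
  by (rule measurable_srs_steps[OF f]) measurable

lemma measurable_srs_kernel [measurable]: "srs_kernel M v f \<in> borel \<rightarrow>\<^sub>M subprob_algebra borel"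
  unfolding srs_kernel_def
  by (rule measurable_distr2[where M = M]) measurable

lemma prob_space_srs_kernel: "prob_space (srs_kernel M v f x)"
  unfolding srs_kernel_def by (rule prob_space_distr) measurable

text \<open>
  The state after \<open>n\<close> steps is a function of the inputs at times \<open>k, \<dots>, k + n - 1\<close>, hence independent
  of the input at time \<open>k + n\<close>. State and input have different types, whereas \<open>indep_var\<close> compares
  variables of one type. So independence is applied to the two blocks of inputs, and pushing their
  product measure forward carries it over to the state.
\<close>

lemma joint_law_path_next_input:
  "distr M (borel \<Otimes>\<^sub>M borel) (\<lambda>\<omega>. (srs_steps f (\<lambda>i. v i \<omega>) k s n, v (k + int n) \<omega>)) =
     srs_law f k n s \<Otimes>\<^sub>M distr M borel (v (k + int n))"
proof -
  let ?past = "{k..<k + int n}" and ?next = "{k + int n}"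
  let ?P = "PiM ?past (\<lambda>_. borel)" and ?N = "PiM ?next (\<lambda>_. borel)"
  let ?p = "\<lambda>\<omega>. restrict (\<lambda>i. v i \<omega>) ?past" and ?n = "\<lambda>\<omega>. restrict (\<lambda>i. v i \<omega>) ?next"
  let ?\<phi> = "\<lambda>w. srs_steps f w k s n" and ?\<psi> = "\<lambda>w. w (k + int n)"
  have "indep_var ?P ?p ?N ?n"
    by (rule indep_var_restrict[OF indep]) auto
  then have p: "?p \<in> M \<rightarrow>\<^sub>M ?P" and n: "?n \<in> M \<rightarrow>\<^sub>M ?N"
    and joint: "distr M ?P ?p \<Otimes>\<^sub>M distr M ?N ?n = distr M (?P \<Otimes>\<^sub>M ?N) (\<lambda>\<omega>. (?p \<omega>, ?n \<omega>))"
    by (auto simp: indep_var_distribution_eq)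
  have path: "?\<phi> \<in> ?P \<rightarrow>\<^sub>M borel"
    by (rule measurable_srs_steps[OF f]) (auto intro: measurable_component_singleton)
  have component: "?\<psi> \<in> ?N \<rightarrow>\<^sub>M borel"
    by (auto intro: measurable_component_singleton)
  have restrict: "srs_steps f (?p \<omega>) k s m = srs_steps f (\<lambda>i. v i \<omega>) k s m" if "m \<le> n" for \<omega> m
    using that by (induction m) auto
  have "srs_law f k n s = distr (distr M ?P ?p) borel ?\<phi>"
    using path p by (simp add: distr_distr comp_def restrict srs_law_def)
  moreover have next_law: "distr M borel (v (k + int n)) = distr (distr M ?N ?n) borel ?\<psi>"
    using component n by (simp add: distr_distr comp_def)
  moreover have "prob_space (distr (distr M ?N ?n) borel ?\<psi>)"
    unfolding next_law[symmetric] by (rule prob_space_distr) measurable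
  ultimately have "srs_law f k n s \<Otimes>\<^sub>M distr M borel (v (k + int n)) =
      distr (distr M ?P ?p \<Otimes>\<^sub>M distr M ?N ?n) (borel \<Otimes>\<^sub>M borel) (\<lambda>(x, u). (?\<phi> x, ?\<psi> u))"
    using path component
    by (simp add: pair_measure_distr prob_space_imp_sigma_finite)
  also have "\<dots> = distr M (borel \<Otimes>\<^sub>M borel)
      ((\<lambda>(x, u). (?\<phi> x, ?\<psi> u)) \<circ> (\<lambda>\<omega>. (?p \<omega>, ?n \<omega>)))"
    unfolding joint
  proof (rule distr_distr)
    show "(\<lambda>(x, u). (?\<phi> x, ?\<psi> u)) \<in> ?P \<Otimes>\<^sub>M ?N \<rightarrow>\<^sub>M borel \<Otimes>\<^sub>M borel"
      unfolding split_beta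
      by (intro measurable_Pair measurable_compose[OF measurable_fst path]
            measurable_compose[OF measurable_snd component])
  qed (intro measurable_Pair p n)
  finally show ?thesis
    by (simp add: comp_def restrict)
qed

lemma srs_law_0: "srs_law f k 0 s = return borel s"
  by (simp add: srs_law_def)

text \<open>
  The Markov property: integrate out the last input, which is independent of the current state and has the
  same law as the input at time 0 used in the kernel.
\<close>

lemma srs_law_Suc: "srs_law f k (Suc n) s = srs_law f k n s \<bind> srs_kernel M v f"
proof (rule measure_eqI)
  let ?\<nu> = "distr M borel (v (k + int n))"
  interpret \<nu>: prob_space ?\<nu>
    by (rule prob_space_distr) measurable
  have kernel: "srs_kernel M v f x = distr ?\<nu> borel (\<lambda>u. f (x, u))" for x
    unfolding srs_kernel_def ident[of "k + int n" 0]
    by (subst distr_distr) (auto simp: comp_def)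
  show "sets (srs_law f k (Suc n) s) = sets (srs_law f k n s \<bind> srs_kernel M v f)"
    by (subst sets_bind[where N = borel]) (auto simp: srs_law_def srs_kernel_def)
  fix A assume "A \<in> sets (srs_law f k (Suc n) s)"
  then have A [measurable]: "A \<in> sets borel"
    by (simp add: srs_law_def)
  have "srs_law f k (Suc n) s =
      distr (distr M (borel \<Otimes>\<^sub>M borel) (\<lambda>\<omega>. (srs_steps f (\<lambda>i. v i \<omega>) k s n, v (k + int n) \<omega>))) borel f"
    by (subst distr_distr) (auto simp: srs_law_def comp_def)
  also have "\<dots> = distr (srs_law f k n s \<Otimes>\<^sub>M ?\<nu>) borel f"
    by (simp only: joint_law_path_next_input)
  finally have law: "srs_law f k (Suc n) s = distr (srs_law f k n s \<Otimes>\<^sub>M ?\<nu>) borel f" .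
  have sets_pair: "sets (srs_law f k n s \<Otimes>\<^sub>M ?\<nu>) = sets (borel \<Otimes>\<^sub>M borel)"
    by (intro sets_pair_measure_cong) (auto simp: srs_law_def)
  have f': "f \<in> srs_law f k n s \<Otimes>\<^sub>M ?\<nu> \<rightarrow>\<^sub>M borel"
    using f by (simp add: measurable_cong_sets[OF sets_pair])
  have "emeasure (srs_law f k (Suc n) s) A =
      (\<integral>\<^sup>+x. emeasure ?\<nu> (Pair x -` (f -` A \<inter> space (srs_law f k n s \<Otimes>\<^sub>M ?\<nu>))) \<partial>srs_law f k n s)"
    unfolding law emeasure_distr[OF f' A]
    by (rule \<nu>.emeasure_pair_measure_alt[OF measurable_sets[OF f' A]])
  also have "\<dots> = (\<integral>\<^sup>+x. emeasure (srs_kernel M v f x) A \<partial>srs_law f k n s)"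
    by (intro nn_integral_cong)
      (auto simp: kernel emeasure_distr space_pair_measure srs_law_def vimage_def intro!: arg_cong2[where f = emeasure])
  also have "\<dots> = emeasure (srs_law f k n s \<bind> srs_kernel M v f) A"
    by (subst emeasure_bind[where N = borel]) (auto simp: srs_law_def)
  finally show "emeasure (srs_law f k (Suc n) s) A = emeasure (srs_law f k n s \<bind> srs_kernel M v f) A" .
qed

lemma srs_law_shift: "srs_law f k n s = srs_law f l n s"
  by (induction n) (simp_all add: srs_law_0 srs_law_Suc)

lemma measurable_srs_law: "srs_law f k n \<in> borel \<rightarrow>\<^sub>M subprob_algebra borel"
proof (induction n)
  case 0
  then show ?case
    by (simp add: srs_law_0[abs_def] return_measurable)
next
  case (Suc n)
  then show ?case
    by (simp add: srs_law_Suc[abs_def] measurable_bind2[OF _ measurable_srs_kernel])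
qed

lemma stationary_distribution_iff_bind:
  "stationary_distribution (srs_kernel M v f) \<pi> \<longleftrightarrow>
     prob_space \<pi> \<and> sets \<pi> = sets borel \<and> \<pi> \<bind> srs_kernel M v f = \<pi>"
proof (cases "prob_space \<pi> \<and> sets \<pi> = sets borel")
  case True
  then interpret \<pi>: prob_space \<pi> by simp
  have s: "sets \<pi> = sets borel" using True by simp
  have K: "srs_kernel M v f \<in> \<pi> \<rightarrow>\<^sub>M subprob_algebra borel"
    using measurable_srs_kernel by (simp add: measurable_cong_sets[OF s])
  have "emeasure (\<pi> \<bind> srs_kernel M v f) A = (\<integral>\<^sup>+x. emeasure (srs_kernel M v f x) A \<partial>\<pi>)"
    if "A \<in> sets borel" for A
    using that \<pi>.not_empty K by (intro emeasure_bind)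
  moreover have "sets (\<pi> \<bind> srs_kernel M v f) = sets borel"
    using \<pi>.not_empty K by (intro sets_bind_measurable)
  ultimately show ?thesis
    using True by (auto simp: stationary_distribution_def s intro!: measure_eqI)
qed (auto simp: stationary_distribution_def)

lemma stationary_distribution_bind_srs_law:
  assumes "stationary_distribution (srs_kernel M v f) \<pi>"
  shows "\<pi> \<bind> srs_law f k n = \<pi>"
proof -
  have s: "sets \<pi> = sets borel" and inv: "\<pi> \<bind> srs_kernel M v f = \<pi>"
    using assms by (auto simp: stationary_distribution_iff_bind)
  show ?thesis
  proof (induction n)
    case 0
    then show ?case
      by (simp add: srs_law_0[abs_def] bind_return''[OF s])
  next
    case (Suc n)
    have "\<pi> \<bind> srs_law f k (Suc n) = \<pi> \<bind> (\<lambda>x. srs_law f k n x \<bind> srs_kernel M v f)"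
      by (simp add: srs_law_Suc[abs_def])
    also have "\<dots> = (\<pi> \<bind> srs_law f k n) \<bind> srs_kernel M v f"
      by (intro bind_assoc[symmetric, where N = borel and R = borel])
        (simp_all add: measurable_srs_law measurable_cong_sets[OF s refl])
    finally show ?case
      by (simp add: Suc inv)
  qed
qed

section \<open>Backward coupling\<close>

context
  fixes Z :: "'w \<Rightarrow> 's"
  assumes Z [measurable]: "Z \<in> M \<rightarrow>\<^sub>M borel"
    and coupling: "\<And>x. AE \<omega> in M. \<forall>\<^sub>F n in sequentially. srs_steps f (\<lambda>i. v i \<omega>) (- int n) x n = Z \<omega>"
begin

text \<open>
  By time invariance the \<open>n\<close>-step law may be realized on the path that starts at time \<open>-n\<close> and ends at
  time 0. Almost surely this realization is eventually equal to \<open>Z\<close>, so its image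
  under \<open>h\<close> is eventually \<open>h (Z \<omega>)\<close>.
\<close>

lemma nn_integral_srs_law_tendsto:
  assumes h [measurable]: "h \<in> borel \<rightarrow>\<^sub>M borel" and bound: "\<And>x. h x \<le> (1 :: ennreal)"
  shows "(\<lambda>n. \<integral>\<^sup>+z. h z \<partial>srs_law f k n x) \<longlonglongrightarrow> (\<integral>\<^sup>+z. h z \<partial>distr M borel Z)"
proof -
  have "(\<lambda>n. \<integral>\<^sup>+\<omega>. h (srs_steps f (\<lambda>i. v i \<omega>) (- int n) x n) \<partial>M) \<longlonglongrightarrow> (\<integral>\<^sup>+\<omega>. h (Z \<omega>) \<partial>M)"
  proof (rule nn_integral_dominated_convergence[where w = "\<lambda>_. 1"])
    show "AE \<omega> in M. (\<lambda>n. h (srs_steps f (\<lambda>i. v i \<omega>) (- int n) x n)) \<longlonglongrightarrow> h (Z \<omega>)"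
      using coupling[of x]
    proof eventually_elim
      case (elim \<omega>)
      then show ?case
        by (intro tendsto_eventually) (auto elim: eventually_mono)
    qed
  qed (auto simp: bound emeasure_space_1)
  moreover have "(\<integral>\<^sup>+z. h z \<partial>srs_law f k n x) =
      (\<integral>\<^sup>+\<omega>. h (srs_steps f (\<lambda>i. v i \<omega>) (- int n) x n) \<partial>M)" for n
    unfolding srs_law_shift[of k n x "- int n"] by (simp add: srs_law_def nn_integral_distr)
  ultimately show ?thesis
    by (simp add: nn_integral_distr)
qed

lemma emeasure_srs_law_tendsto:
  assumes A: "A \<in> sets borel"
  shows "(\<lambda>n. emeasure (srs_law f k n x) A) \<longlonglongrightarrow> emeasure (distr M borel Z) A"
proof -
  have "(\<lambda>n. \<integral>\<^sup>+z. indicator A z \<partial>srs_law f k n x) \<longlonglongrightarrow> (\<integral>\<^sup>+z. indicator A z \<partial>distr M borel Z)"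
    using A by (intro nn_integral_srs_law_tendsto) (auto simp: indicator_def)
  then show ?thesis
    using A by (simp add: srs_law_def)
qed

text \<open>
  The probability of \<open>A\<close> after \<open>n + 1\<close> steps is the integral over the \<open>n\<close>-step law of the bounded
  measurable function \<open>z \<mapsto> srs_kernel M v f z A\<close>. Both expressions converge, and their limits are the two
  sides of the stationarity equation.
\<close>

lemma stationary_distribution_coupling_limit:
  "stationary_distribution (srs_kernel M v f) (distr M borel Z)"
  unfolding stationary_distribution_def
proof (intro conjI ballI)
  fix A :: "'s set" assume A [measurable]: "A \<in> sets borel"
  have "(\<lambda>n. \<integral>\<^sup>+z. emeasure (srs_kernel M v f z) A \<partial>srs_law f 0 n undefined)
      \<longlonglongrightarrow> (\<integral>\<^sup>+z. emeasure (srs_kernel M v f z) A \<partial>distr M borel Z)"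
    using prob_space.emeasure_le_1[OF prob_space_srs_kernel]
    by (intro nn_integral_srs_law_tendsto) measurable
  moreover have "(\<integral>\<^sup>+z. emeasure (srs_kernel M v f z) A \<partial>srs_law f 0 n undefined) =
      emeasure (srs_law f 0 (Suc n) undefined) A" for n
    unfolding srs_law_Suc
    by (subst emeasure_bind[where N = borel]) (auto simp: srs_law_def)
  ultimately have "(\<lambda>n. emeasure (srs_law f 0 (Suc n) undefined) A)
      \<longlonglongrightarrow> (\<integral>\<^sup>+z. emeasure (srs_kernel M v f z) A \<partial>distr M borel Z)"
    by simp
  moreover have "(\<lambda>n. emeasure (srs_law f 0 (Suc n) undefined) A) \<longlonglongrightarrow> emeasure (distr M borel Z) A"
    using emeasure_srs_law_tendsto[OF A] by (rule LIMSEQ_Suc)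
  ultimately show "emeasure (distr M borel Z) A = (\<integral>\<^sup>+z. emeasure (srs_kernel M v f z) A \<partial>distr M borel Z)"
    by (intro LIMSEQ_unique)
qed (auto intro: prob_space_distr)

text \<open>
  Running the chain from a stationary \<open>\<pi>\<close> for \<open>n\<close> steps leaves \<open>\<pi>\<close> unchanged, while from every
  single starting point the \<open>n\<close>-step law converges to the law of \<open>Z\<close>. Dominated convergence under \<open>\<pi>\<close>
  identifies the two.
\<close>

lemma stationary_distribution_unique:
  assumes \<pi>: "stationary_distribution (srs_kernel M v f) \<pi>"
  shows "\<pi> = distr M borel Z"
proof (rule measure_eqI)
  interpret \<pi>: prob_space \<pi>
    using \<pi> by (simp add: stationary_distribution_def)
  have s: "sets \<pi> = sets borel"
    using \<pi> by (simp add: stationary_distribution_def)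
  then show "sets \<pi> = sets (distr M borel Z)"
    by simp
  fix A assume "A \<in> sets \<pi>"
  then have A: "A \<in> sets borel"
    using s by simp
  have law: "srs_law f 0 n \<in> \<pi> \<rightarrow>\<^sub>M subprob_algebra borel" for n
    using measurable_srs_law by (simp add: measurable_cong_sets[OF s])
  have "(\<lambda>n. \<integral>\<^sup>+x. emeasure (srs_law f 0 n x) A \<partial>\<pi>) \<longlonglongrightarrow> (\<integral>\<^sup>+x. emeasure (distr M borel Z) A \<partial>\<pi>)"
  proof (rule nn_integral_dominated_convergence[where w = "\<lambda>_. 1"])
    show "(\<lambda>x. emeasure (srs_law f 0 n x) A) \<in> borel_measurable \<pi>" for n
      using A law by (rule measurable_emeasure_kernel[rotated])
    have "emeasure (srs_law f 0 n x) A \<le> 1" for n x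
      unfolding srs_law_def by (intro prob_space.emeasure_le_1 prob_space_distr) measurable
    then show "AE x in \<pi>. emeasure (srs_law f 0 n x) A \<le> 1" for n
      by simp
  qed (auto simp: emeasure_srs_law_tendsto[OF A] \<pi>.emeasure_space_1)
  moreover have "(\<integral>\<^sup>+x. emeasure (srs_law f 0 n x) A \<partial>\<pi>) = emeasure \<pi> A" for n
    using emeasure_bind[OF \<pi>.not_empty law A] by (simp add: stationary_distribution_bind_srs_law[OF \<pi>])
  ultimately show "emeasure \<pi> A = emeasure (distr M borel Z) A"
    by (simp add: LIMSEQ_const_iff \<pi>.emeasure_space_1)
qed

end

end

section \<open>Termination\<close>

text \<open>
  The events for the starting times \<open>-2\<^sup>j\<close> need not be nested, but the probability of their union is
  at least that of each of them. By time invariance the latter is the probability of hitting \<open>e\<close> within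
  \<open>2\<^sup>j\<close> steps from time 0, which tends to 1.
\<close>

lemma AE_hits_from_the_past:
  fixes g :: "'s::metric_space \<times> 'v \<Rightarrow> 's"
  assumes g: "g \<in> borel \<Otimes>\<^sub>M borel \<rightarrow>\<^sub>M borel"
    and hit: "prob {\<omega> \<in> space M. generic_hitting_time g v y e \<omega> < \<infinity>} = 1"
  shows "AE \<omega> in M. \<exists>j. \<exists>i. start_time j \<le> i \<and> i \<le> 0 \<and> srs g (\<lambda>n. v n \<omega>) (start_time j) y i = e"
proof -
  define hit_by where
    "hit_by k n = {\<omega> \<in> space M. srs_steps (stopped g e) (\<lambda>i. v i \<omega>) k y n = e}" for k n
  note sg = measurable_stopped[OF g, of e]
  have hit_by_vimage: "hit_by k n = (\<lambda>\<omega>. srs_steps (stopped g e) (\<lambda>i. v i \<omega>) k y n) -` {e} \<inter> space M" for k n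
    by (auto simp: hit_by_def)
  have [measurable]: "hit_by k n \<in> sets M" for k n
    unfolding hit_by_vimage by (rule measurable_sets[OF measurable_path[OF sg]]) simp
  have "emeasure M (hit_by k n) = emeasure (srs_law (stopped g e) k n y) {e}" for k n
    unfolding srs_law_def hit_by_vimage by (rule emeasure_distr[OF measurable_path[OF sg], symmetric]) simp
  then have shift: "prob (hit_by k n) = prob (hit_by 0 n)" for k n
    using srs_law_shift[OF sg, of k n y 0] by (simp add: measure_def)
  have "(\<lambda>n. prob (hit_by 0 n)) \<longlonglongrightarrow> prob (\<Union>n. hit_by 0 n)"
  proof (rule finite_Lim_measure_incseq)
    show "incseq (hit_by 0)"
      by (rule incseq_SucI) (auto simp: hit_by_def stopped_def)
  qed auto
  also have "(\<Union>n. hit_by 0 n) = {\<omega> \<in> space M. generic_hitting_time g v y e \<omega> < \<infinity>}"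
    unfolding generic_hitting_time_def hitting_time_finite_iff by (auto simp: hit_by_def)
  finally have "(\<lambda>n. prob (hit_by 0 n)) \<longlonglongrightarrow> 1"
    by (simp only: hit)
  moreover have "filterlim (\<lambda>j::nat. 2 ^ j :: nat) sequentially sequentially"
    by (intro filterlim_subseq) (simp add: strict_mono_def)
  ultimately have "(\<lambda>j. prob (hit_by 0 (2 ^ j))) \<longlonglongrightarrow> 1"
    by (rule filterlim_compose)
  moreover have "prob (hit_by 0 (2 ^ j)) \<le> prob (\<Union>j. hit_by (start_time j) (2 ^ j))" for j
    unfolding shift[of "start_time j", symmetric] by (intro finite_measure_mono) auto
  ultimately have "1 \<le> prob (\<Union>j. hit_by (start_time j) (2 ^ j))"
    by (intro LIMSEQ_le_const2) auto
  then have "prob (\<Union>j. hit_by (start_time j) (2 ^ j)) = 1"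
    using prob_le_1 by (intro antisym) auto
  then have "AE \<omega> in M. \<omega> \<in> (\<Union>j. hit_by (start_time j) (2 ^ j))"
    by (subst (asm) prob_eq_1) auto
  then show ?thesis
  proof eventually_elim
    case (elim \<omega>)
    then obtain j where "srs_steps (stopped g e) (\<lambda>i. v i \<omega>) (start_time j) y (2 ^ j) = e"
      by (auto simp: hit_by_def)
    then obtain m where m: "m \<le> 2 ^ j" "srs_steps g (\<lambda>i. v i \<omega>) (start_time j) y m = e"
      by (auto simp: srs_steps_stopped split: if_splits)
    have "int m \<le> 2 ^ j"
      using m(1) by (metis of_nat_le_iff of_nat_numeral of_nat_power)
    then show ?case
      using m(2) by (intro exI[of _ j] exI[of _ "start_time j + int m"]) (auto simp: srs_def start_time_def)
  qed
qed

lemma measurable_control_nonempty: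
  fixes g :: "'s::metric_space \<times> 'v \<Rightarrow> 's"
  assumes g: "g \<in> borel \<Otimes>\<^sub>M borel \<rightarrow>\<^sub>M borel"
  shows "Measurable.pred M (\<lambda>\<omega>. control_times g (\<lambda>n. v n \<omega>) q b y T \<noteq> {})"
proof -
  have "Measurable.pred M (\<lambda>\<omega>. srs g (\<lambda>n. v n \<omega>) T y i \<in> b ` {1..q})" for i
    unfolding srs_def
    by (intro pred_sets1[OF _ measurable_path[OF g]] borel_closed finite_imp_closed) simp
  then have "Measurable.pred M (\<lambda>\<omega>. \<exists>i. T \<le> i \<and> i \<le> 0 \<and> srs g (\<lambda>n. v n \<omega>) T y i \<in> b ` {1..q})"
    by measurable
  then show ?thesis
    by (simp only: control_times_def mem_Collect_eq flip: ex_in_conv)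
qed

end

theorem theorem1:
  fixes M :: "'w measure"
    and v :: "int \<Rightarrow> 'w \<Rightarrow> 'v::metric_space"
    and f :: "'x::metric_space \<times> 'v \<Rightarrow> 'x"
    and g :: "'y::metric_space \<times> 'v \<Rightarrow> 'y"
    and q :: nat
    and b :: "nat \<Rightarrow> 'y" and y :: 'y and a :: "nat \<Rightarrow> 'x"
  assumes "separable_space (euclidean :: 'x topology)"
    and "separable_space (euclidean :: 'y topology)"
    and "separable_space (euclidean :: 'v topology)"
    and "f \<in> borel \<Otimes>\<^sub>M borel \<rightarrow>\<^sub>M borel"
    and "g \<in> borel \<Otimes>\<^sub>M borel \<rightarrow>\<^sub>M borel"
    and "iid_sequence M v"
    and "q \<ge> 1"
    and "q_controls M v g f q b y a"
    and "\<And>i. i \<in> {1..q} \<Longrightarrow>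
           measure M {\<omega> \<in> space M. generic_hitting_time g v y (b i) \<omega> < \<infinity>} = 1"
  shows "(AE \<omega> in M. control_sampling f g (\<lambda>n. v n \<omega>) q b y a \<noteq> None) \<and>
         (\<lambda>\<omega>. the (control_sampling f g (\<lambda>n. v n \<omega>) q b y a)) \<in> M \<rightarrow>\<^sub>M borel \<and>
         (\<exists>\<pi>. stationary_distribution (srs_kernel M v f) \<pi> \<and>
              (\<forall>\<pi>'. stationary_distribution (srs_kernel M v f) \<pi>' \<longrightarrow> \<pi>' = \<pi>) \<and>
              distr M borel (\<lambda>\<omega>. the (control_sampling f g (\<lambda>n. v n \<omega>) q b y a)) = \<pi>)"
proof -
  interpret prob_space M
    using assms(6) by (simp add: iid_sequence_def)
  interpret iid_inputs M v
    using assms(6) by unfold_locales (auto simp: iid_sequence_def)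
  let ?vs = "\<lambda>\<omega> n. v n \<omega>"
  let ?halt = "\<lambda>\<omega> j. control_times g (?vs \<omega>) q b y (start_time j) \<noteq> {}"
  let ?J = "\<lambda>\<omega>. LEAST j. ?halt \<omega> j"
  let ?Z = "\<lambda>\<omega>. the (control_sampling f g (?vs \<omega>) q b y a)"
  have control: "srs f (?vs \<omega>) k x n = a i"
    if "\<omega> \<in> space M" "i \<in> {1..q}" "k \<le> n" "srs g (?vs \<omega>) k y n = b i" for \<omega> i k n x
    using that assms(8) by (auto simp: q_controls_def)
  have result: "control_sampling f g (?vs \<omega>) q b y a = Some (srs f (?vs \<omega>) T x 0)"
    if "\<omega> \<in> space M" "\<exists>j. ?halt \<omega> j" "T \<le> start_time (?J \<omega>)" for \<omega> T x
    using that by (intro control_sampling_eq control)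
  have halts: "AE \<omega> in M. \<exists>j. ?halt \<omega> j"
    using AE_hits_from_the_past[OF assms(5) assms(9)[of 1]] assms(7)
    by (force simp: control_times_def elim: eventually_mono)
  have none: "AE \<omega> in M. control_sampling f g (?vs \<omega>) q b y a \<noteq> None"
    using halts by eventually_elim (simp add: control_sampling_def Let_def)
  \<comment> \<open>On halting realizations the output is the path from the successful starting time. Its initial point
    does not matter, so it may be fixed to make the output a countable patchwork of measurable maps.\<close>
  note [measurable] = measurable_control_nonempty[OF assms(5)]
  have "(\<lambda>\<omega>. srs f (?vs \<omega>) (start_time j) undefined 0) \<in> M \<rightarrow>\<^sub>M borel" for j
    unfolding srs_def by (rule measurable_path[OF assms(4)])
  then have [measurable]: "(\<lambda>\<omega>. srs f (?vs \<omega>) (start_time (?J \<omega>)) undefined 0) \<in> M \<rightarrow>\<^sub>M borel"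
    by (rule measurable_compose_countable) measurable
  have "(\<lambda>\<omega>. if \<exists>j. ?halt \<omega> j then srs f (?vs \<omega>) (start_time (?J \<omega>)) undefined 0 else the None) \<in> M \<rightarrow>\<^sub>M borel"
    by measurable
  moreover have "?Z \<omega> = (if \<exists>j. ?halt \<omega> j then srs f (?vs \<omega>) (start_time (?J \<omega>)) undefined 0 else the None)"
    if "\<omega> \<in> space M" for \<omega>
    using result[OF that, of "start_time (?J \<omega>)" undefined] by (auto simp: control_sampling_def)
  ultimately have Z: "?Z \<in> M \<rightarrow>\<^sub>M borel"
    by (simp cong: measurable_cong)
  have "AE \<omega> in M. \<forall>\<^sub>F n in sequentially. srs_steps f (?vs \<omega>) (- int n) x n = ?Z \<omega>" for x
    using halts AE_space
  proof eventually_elim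
    case (elim \<omega>)
    show ?case
      using eventually_ge_at_top[of "nat (- start_time (?J \<omega>))"]
    proof eventually_elim
      case (elim n)
      then show ?case
        using result[OF \<open>\<omega> \<in> space M\<close> \<open>\<exists>j. ?halt \<omega> j\<close>, of "- int n" x] by (simp add: srs_def)
    qed
  qed
  note coupling = assms(4) Z this
  show ?thesis
    using none Z stationary_distribution_coupling_limit[OF coupling]
      stationary_distribution_unique[OF coupling] by blast
qed

end
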